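(* Assume the hypotheses (H0)–(H3) listed in the context and let $\delta_0>0$ and $\epsilon>0$ be sufficiently small. In addition assume that there exists a locally unique equilibrium of the system $\dot w_0=\epsilon J_{\mathcal W}\nabla_wH_0(w_0,z_0)$, $\dot z_0=J_{\mathcal Z}\nabla_zH_0(w_0,z_0)$ which in the $(w_0,z_0)$-coordinates takes the form $(w^e,0)\in\mathcal V\times\mathcal S$. Then the equilibrium $(w^e,0)$ is a fixed point of the symplectic transformation $\Psi$ described in the context.
   Context: Spaces. $\mathcal W=\mathbb R^{2d_{\mathcal W}}$ with points $w=(u,v)$ and $J_{\mathcal W}=\begin{pmatrix}0&\mathrm{id}\\-\mathrm{id}&0\end{pmatrix}$. $\mathcal Z$ is a real Hilbert space (possibly infinite dimensional) with inner product $\langle\cdot,\cdot\rangle$ and norm $\|\cdot\|$. $\mathcal W^{\mathbb C},\mathcal Z^{\mathbb C}$ are the complexifications; $\langle\cdot,\cdot\rangle$ is extended to a complex bilinear form on $\mathcal Z^{\mathbb C}$. $\mathcal E(X;Y)$ is the space of bounded linear operators, $\mathcal E(X)=\mathcal E(X;X)$. $\mathcal V+\mathrm i\nu=\{w\in\mathcal W^{\mathbb C}:\mathrm{dist}(w,\mathcal V)<\nu\}$, and similarly $\mathcal S+\mathrm i\sigma\subset\mathcal Z^{\mathbb C}$. Analytic means continuously complex (Fréchet) differentiable; real analytic means analytic and real valued at real arguments. $\|g\|_{\nu;X}$, $\|g\|_{\nu,\sigma;X}$ denote suprema of the $X$-norm over $\mathcal V+\mathrm i\nu$, respectively $(\mathcal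 V+\mathrm i\nu)\times(\mathcal S+\mathrm i\sigma)$. System. $H_0(w,z)=\frac12\langle Lz,z\rangle+V_0(w,z)$, with $J_{\mathcal Z}\nabla_zV_0:(\mathcal V+\mathrm i\nu_0)\times(\mathcal S+\mathrm i\sigma_0)\to\mathcal Z^{\mathbb C}$ analytic; $\nabla_z$ is defined by $\partial_zH\,\tilde z=\langle\nabla_zH,\tilde z\rangle$. $\mathcal Z_1:=D(J_{\mathcal Z})$ with norm $\|z\|_{\mathcal Z_1}=\|J_{\mathcal Z}z\|$, and $\|J_{\mathcal Z}^{-1}\|_{\mathcal E(\mathcal Z)}\le1$. The symplectic form is $\omega((w_1,z_1),(w_2,z_2))=\epsilon^{-1}(\langle u_1,v_2\rangle-\langle u_2,v_1\rangle)+\langle J_{\mathcal Z}^{-1}z_1,z_2\rangle$. Expansion: $H_0(w,z)=h_0(w)+\langle r_0(w),z\rangle+\frac12\langle(L+a_0(w))z,z\rangle+f_0(w,z)$, $f_0=\mathcal O(\|z\|^3)$, $F_0=\nabla_zf_0$, $A_0=L+a_0$. Hypotheses. (H0) $J_{\mathcal Z}$ and $J_{\mathcal Z}L$ are densely defined, closed, skew-symmetric, invertible linear operators on $\mathcal Z$, and $L$ is bounded and self-adjoint. (H1) $H_0$ is real analytic and uniformly bounded on $(\mathcal V+\mathrm i\nu_0)\times(\mathcal S+\mathrm i\sigma_0)$, $\mathcal V\subset\mathcal W$ open, $\mathcal S\subset\mathcal Z$ an open neighbourhood of $0$, $\sigma_0,\nu_0>0$, and $C_{\mathcal S}=\sup_{z\in\mathcal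 S+\mathrm i\sigma_0}\|z\|<\infty$. (H2) $a_0:\mathcal V+\mathrm i\nu_0\to\mathcal E(\mathcal Z^{\mathbb C};\mathcal Z_1^{\mathbb C})$ is real analytic and bounded by $C_{a_0}$, and $\sup_{w\in\mathcal V+\mathrm i\nu_0}\|A_0(w)^{-1}\|_{\mathcal E(\mathcal Z_1^{\mathbb C})}\le K_0/2$. (H3) $r_0:\mathcal V+\mathrm i\nu_0\to\mathcal Z_1^{\mathbb C}$, $h_0$, $f_0$, and $F_0:(\mathcal V+\mathrm i\nu_0)\times(\mathcal S+\mathrm i\sigma_0)\to\mathcal Z_1^{\mathbb C}$ are real analytic with $\|r_0\|_{\nu_0;\mathcal Z_1^{\mathbb C}}\le\delta_0$, $\|h_0\|_{\nu_0;\mathbb C}\le C_{h_0}$, $\|\partial_wh_0\|_{\nu_0}\le C_{h_0}'$, $\|F_0\|_{\nu_0,\sigma_0;\mathcal Z_1^{\mathbb C}}\le C_{F_0}$, $\|f_0\|_{\nu_0,\sigma_0;\mathbb C}\le C_{f_0}$. The transformation $\Psi$. For $\delta_0$ small the equation $r_0(w)+A_0(w)z+F_0(w,z)=0$ has a locally unique solution $z=\zeta(w)\in\mathcal Z_1^{\mathbb C}$, analytic in $w\in\mathcal V+\mathrm i\nu_0$, with $\|\zeta(w)\|_{\mathcal Z_1}\le K_0\|r_0(w)\|_{\mathcal Z_1}$. There are complementary orthogonal projectors $\mathbb P_x,\mathbb P_y$ on $\mathcal Z$ ($\mathbb P_x+\mathbb P_y=\mathrm{id}$, $\mathbb P_x\mathbb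 P_y=0$, $\mathbb P_x\mathcal Z\perp\mathbb P_y\mathcal Z$) such that, writing $z=(x,y)$ with $x=\mathbb P_xz$, $y=\mathbb P_yz$, $\zeta^x=\mathbb P_x\zeta$, $\zeta^y=\mathbb P_y\zeta$, and $g(u,v_+,x,y_+)=-\langle J_{\mathcal Z}^{-1}\zeta(u,v_+),(x,y_+)\rangle$, the map $\Psi:(w_+,z_+)=(u_+,v_+,x_+,y_+)\mapsto(u,v,x,y)$ given implicitly by $$x_+=x-\zeta^x(u,v_+),\quad y=y_++\zeta^y(u,v_+),\quad u_+=u+\epsilon\nabla_{v_+}g(u,v_+,x,y_+),\quad v=v_++\epsilon\nabla_ug(u,v_+,x,y_+)$$ is symplectic; for any fixed $\xi\in(0,\min(\nu_0,\sigma_0))$ and $\delta_0,\epsilon$ sufficiently small it is a well-defined analytic map from $(\mathcal V+\mathrm i(\nu_0-\xi))\times(\mathcal S+\mathrm i(\sigma_0-\xi))$ to $(\mathcal V+\mathrm i(\nu_0-\xi/2))\times(\mathcal S+\mathrm i(\sigma_0-\xi/2))$, with $\|u-u_+\|\le\xi/2$, the solution $u$ of the implicit equation in this range being unique. *)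

theory Defs
  imports "HOL-Analysis.Analysis" "HOL-Library.Landau_Symbols"
begin

section \<open>Complex normed spaces and complexification\<close>

class complex_normed_vector = real_normed_vector +
  fixes scaleC :: "complex \<Rightarrow> 'a \<Rightarrow> 'a" (infixr \<open>*\<^sub>C\<close> 75)
  assumes scaleC_add_right: "c *\<^sub>C (x + y) = c *\<^sub>C x + c *\<^sub>C y"
    and scaleC_add_left: "(c + d) *\<^sub>C x = c *\<^sub>C x + d *\<^sub>C x"
    and scaleC_scaleC: "c *\<^sub>C d *\<^sub>C x = (c * d) *\<^sub>C x"
    and scaleC_of_real: "complex_of_real r *\<^sub>C x = r *\<^sub>R x"
    and norm_scaleC: "norm (c *\<^sub>C x) = cmod c * norm x"

instantiation complex :: complex_normed_vector
begin
definition scaleC_complex :: "complex \<Rightarrow> complex \<Rightarrow> complex" where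
  "scaleC_complex c x = c * x"
instance
  by standard (auto simp: scaleC_complex_def algebra_simps norm_mult scaleR_conv_of_real)
end

instantiation prod :: (complex_normed_vector, complex_normed_vector) complex_normed_vector
begin
definition scaleC_prod :: "complex \<Rightarrow> 'a \<times> 'b \<Rightarrow> 'a \<times> 'b" where
  "scaleC_prod c p = (c *\<^sub>C fst p, c *\<^sub>C snd p)"
instance
proof
  fix c d :: complex and r :: real and x y :: "'a \<times> 'b"
  show "c *\<^sub>C (x + y) = c *\<^sub>C x + c *\<^sub>C y"
    by (simp add: scaleC_prod_def scaleC_add_right)
  show "(c + d) *\<^sub>C x = c *\<^sub>C x + d *\<^sub>C x"
    by (simp add: scaleC_prod_def scaleC_add_left)
  show "c *\<^sub>C d *\<^sub>C x = (c * d) *\<^sub>C x"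
    by (simp add: scaleC_prod_def scaleC_scaleC)
  show "complex_of_real r *\<^sub>C x = r *\<^sub>R x"
    by (simp add: scaleC_prod_def scaleC_of_real scaleR_prod_def)
  show "norm (c *\<^sub>C x) = cmod c * norm x"
    by (simp add: scaleC_prod_def norm_prod_def norm_scaleC power_mult_distrib
        flip: distrib_left real_sqrt_mult add: real_sqrt_mult)
qed
end

lemma bounded_linear_scaleC: "bounded_linear (\<lambda>x :: 'a :: complex_normed_vector. c *\<^sub>C x)"
proof (rule bounded_linear_intro[where K = "cmod c"])
  show "c *\<^sub>C (x + y) = c *\<^sub>C x + c *\<^sub>C y" for x y :: 'a by (rule scaleC_add_right)
  show "c *\<^sub>C (r *\<^sub>R x) = r *\<^sub>R (c *\<^sub>C x)" for r and x :: 'a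
    by (metis mult.commute scaleC_of_real scaleC_scaleC)
  show "norm (c *\<^sub>C x) \<le> norm x * cmod c" for x :: 'a by (simp add: norm_scaleC)
qed

instantiation blinfun :: (real_normed_vector, complex_normed_vector) complex_normed_vector
begin
lift_definition scaleC_blinfun :: "complex \<Rightarrow> 'a \<Rightarrow>\<^sub>L 'b \<Rightarrow> 'a \<Rightarrow>\<^sub>L 'b" is "\<lambda>c f x. c *\<^sub>C f x"
  by (rule bounded_linear_compose[OF bounded_linear_scaleC])
instance
proof
  fix c d :: complex and r :: real and x y :: "'a \<Rightarrow>\<^sub>L 'b"
  show "c *\<^sub>C (x + y) = c *\<^sub>C x + c *\<^sub>C y"
    by transfer (auto simp: scaleC_add_right)
  show "(c + d) *\<^sub>C x = c *\<^sub>C x + d *\<^sub>C x"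
    by transfer (auto simp: scaleC_add_left)
  show "c *\<^sub>C d *\<^sub>C x = (c * d) *\<^sub>C x"
    by transfer (auto simp: scaleC_scaleC)
  show "complex_of_real r *\<^sub>C x = r *\<^sub>R x"
    by transfer (auto simp: scaleC_of_real)
  show "norm (c *\<^sub>C x) = cmod c * norm x"
  proof transfer
    fix c and f :: "'a \<Rightarrow> 'b" assume "bounded_linear f"
    then have "onorm (\<lambda>x. cmod c *\<^sub>R f x) = cmod c * onorm f"
      by (simp add: onorm_scaleR)
    moreover have "onorm (\<lambda>x. c *\<^sub>C f x) = onorm (\<lambda>x. cmod c *\<^sub>R f x)"
      by (simp add: onorm_def norm_scaleC)
    ultimately show "onorm (\<lambda>x. c *\<^sub>C f x) = cmod c * onorm f" by simp
  qed
qed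
end

text \<open>\<^term>\<open>Cx a b\<close> stands for \<open>a + i b\<close>.\<close>

datatype 'a complexification = Cx (cRe: 'a) (cIm: 'a)

instantiation complexification :: (real_vector) real_vector
begin
definition zero_complexification :: "'a complexification" where
  "zero_complexification = Cx 0 0"
definition plus_complexification ::
    "'a complexification \<Rightarrow> 'a complexification \<Rightarrow> 'a complexification" where
  "plus_complexification x y = Cx (cRe x + cRe y) (cIm x + cIm y)"
definition minus_complexification ::
    "'a complexification \<Rightarrow> 'a complexification \<Rightarrow> 'a complexification" where
  "minus_complexification x y = Cx (cRe x - cRe y) (cIm x - cIm y)"
definition uminus_complexification :: "'a complexification \<Rightarrow> 'a complexification" where
  "uminus_complexification x = Cx (- cRe x) (- cIm x)"
definition scaleR_complexification ::
    "real \<Rightarrow> 'a complexification \<Rightarrow> 'a complexification" where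
  "scaleR_complexification r x = Cx (r *\<^sub>R cRe x) (r *\<^sub>R cIm x)"
instance
  by standard
    (auto simp: zero_complexification_def plus_complexification_def minus_complexification_def
      uminus_complexification_def scaleR_complexification_def algebra_simps)
end

instantiation complexification :: (real_inner) dist_norm
begin
definition norm_complexification :: "'a complexification \<Rightarrow> real" where
  "norm_complexification x = sqrt (cRe x \<bullet> cRe x + cIm x \<bullet> cIm x)"
definition dist_complexification ::
    "'a complexification \<Rightarrow> 'a complexification \<Rightarrow> real" where
  "dist_complexification x y = norm (x - y)"
instance by standard (rule dist_complexification_def)
end

instantiation complexification :: (real_inner) uniformity_dist
begin
definition uniformity_complexification ::
    "('a complexification \<times> 'a complexification) filter" where
  "uniformity_complexification = (INF e\<in>{0<..}. principal {(x, y). dist x y < e})"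
instance by standard (rule uniformity_complexification_def)
end

instantiation complexification :: (real_inner) open_uniformity
begin
definition open_complexification :: "'a complexification set \<Rightarrow> bool" where
  "open_complexification U \<longleftrightarrow> (\<forall>x\<in>U. eventually (\<lambda>(x', y). x' = x \<longrightarrow> y \<in> U) uniformity)"
instance by standard (rule open_complexification_def)
end

instantiation complexification :: (real_inner) real_inner
begin
definition sgn_complexification :: "'a complexification \<Rightarrow> 'a complexification" where
  "sgn_complexification x = x /\<^sub>R norm x"
definition inner_complexification ::
    "'a complexification \<Rightarrow> 'a complexification \<Rightarrow> real" where
  "inner_complexification x y = cRe x \<bullet> cRe y + cIm x \<bullet> cIm y"
instance
  by standard
    (auto simp: zero_complexification_def plus_complexification_def scaleR_complexification_def
      inner_complexification_def norm_complexification_def sgn_complexification_def algebra_simps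
      inner_simps inner_commute add_nonneg_eq_0_iff complexification.expand)
end

instantiation complexification :: (real_inner) complex_normed_vector
begin
definition scaleC_complexification ::
    "complex \<Rightarrow> 'a complexification \<Rightarrow> 'a complexification" where
  "scaleC_complexification c x =
     Cx (Re c *\<^sub>R cRe x - Im c *\<^sub>R cIm x) (Re c *\<^sub>R cIm x + Im c *\<^sub>R cRe x)"
instance
proof
  fix c d :: complex and r :: real and x y :: "'a complexification"
  show "c *\<^sub>C (x + y) = c *\<^sub>C x + c *\<^sub>C y"
    by (simp add: scaleC_complexification_def plus_complexification_def algebra_simps)
  show "(c + d) *\<^sub>C x = c *\<^sub>C x + d *\<^sub>C x"
    by (simp add: scaleC_complexification_def plus_complexification_def algebra_simps)
  show "c *\<^sub>C d *\<^sub>C x = (c * d) *\<^sub>C x"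
    by (simp add: scaleC_complexification_def algebra_simps)
  show "complex_of_real r *\<^sub>C x = r *\<^sub>R x"
    by (simp add: scaleC_complexification_def scaleR_complexification_def)
  have "(c *\<^sub>C x) \<bullet> (c *\<^sub>C x) = (cmod c)\<^sup>2 * (x \<bullet> x)"
    by (simp add: scaleC_complexification_def inner_complexification_def inner_simps cmod_power2)
      (simp add: algebra_simps power2_eq_square inner_commute)
  then show "norm (c *\<^sub>C x) = cmod c * norm x"
    by (simp add: norm_eq_sqrt_inner real_sqrt_mult)
qed
end

definition cx :: "'a :: real_inner \<Rightarrow> 'a complexification" where
  "cx a = Cx a 0"

text \<open>The complex bilinear (not sesquilinear) extension of the inner product.\<close>

definition cinner :: "'a :: real_inner complexification \<Rightarrow> 'a complexification \<Rightarrow> complex" where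
  "cinner x y = Complex (cRe x \<bullet> cRe y - cIm x \<bullet> cIm y) (cRe x \<bullet> cIm y + cIm x \<bullet> cRe y)"

abbreviation cext :: "('a \<Rightarrow> 'b) \<Rightarrow> 'a complexification \<Rightarrow> 'b complexification" where
  "cext T \<equiv> map_complexification T"

definition csub :: "'a set \<Rightarrow> 'a complexification set" where
  "csub D = {z. cRe z \<in> D \<and> cIm z \<in> D}"

type_synonym 'd W = "(real ^ 'd) \<times> (real ^ 'd)"
type_synonym 'd WC = "(real ^ 'd) complexification \<times> (real ^ 'd) complexification"

definition cxW :: "'d :: finite W \<Rightarrow> 'd WC" where
  "cxW w = (cx (fst w), cx (snd w))"

definition tube :: "'a :: metric_space set \<Rightarrow> real \<Rightarrow> 'a set" where
  "tube A r = (\<Union>a\<in>A. ball a r)"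

definition tubeW :: "'d :: finite W set \<Rightarrow> real \<Rightarrow> 'd WC set" where
  "tubeW V \<nu> = tube (cxW ` V) \<nu>"

definition tubeZ :: "'z :: real_inner set \<Rightarrow> real \<Rightarrow> 'z complexification set" where
  "tubeZ S \<sigma> = tube (cx ` S) \<sigma>"

section \<open>Analytic maps and gradients\<close>

definition clinear :: "('a :: complex_normed_vector \<Rightarrow> 'b :: complex_normed_vector) \<Rightarrow> bool" where
  "clinear T \<longleftrightarrow> linear T \<and> (\<forall>c x. T (c *\<^sub>C x) = c *\<^sub>C T x)"

definition canalytic_on ::
    "('a :: complex_normed_vector \<Rightarrow> 'b :: complex_normed_vector) \<Rightarrow> 'a set \<Rightarrow> bool" where
  "canalytic_on f A \<longleftrightarrow> (\<exists>f' :: 'a \<Rightarrow> 'a \<Rightarrow>\<^sub>L 'b.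
     (\<forall>x\<in>A. (f has_derivative blinfun_apply (f' x)) (at x) \<and> clinear (blinfun_apply (f' x))) \<and>
     continuous_on A f')"

definition real_on :: "'a set \<Rightarrow> 'b set \<Rightarrow> ('a \<Rightarrow> 'b) \<Rightarrow> 'a set \<Rightarrow> bool" where
  "real_on RX RY f A \<longleftrightarrow> (\<forall>x \<in> A \<inter> RX. f x \<in> RY)"

text \<open>The space \<open>Z\<^sub>1\<close> is the domain \<open>D\<close> of \<open>J\<close> with the norm \<open>\<parallel>z\<parallel>\<^sub>1 = \<parallel>J z\<parallel>\<close>, so that \<open>J\<close> is an
  isometry of \<open>Z\<^sub>1\<close> onto \<open>Z\<close> when \<open>J\<close> is bijective. Differentiability of \<open>f\<close> in the \<open>Z\<^sub>1\<close>-norm is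
  therefore differentiability of \<open>J \<circ> f\<close> in the norm of \<open>Z\<close>; likewise the norm of
  \<open>E(Z\<^sup>C; Z\<^sub>1\<^sup>C)\<close> is that of \<open>J \<circ> T\<close> in \<open>E(Z\<^sup>C)\<close>.\<close>

definition norm1 :: "('z \<Rightarrow> 'z) \<Rightarrow> 'z :: real_inner complexification \<Rightarrow> real" where
  "norm1 J z = norm (cext J z)"

definition canalytic1_on ::
    "'z set \<Rightarrow> ('z \<Rightarrow> 'z) \<Rightarrow> ('a :: complex_normed_vector \<Rightarrow> 'z :: real_inner complexification)
     \<Rightarrow> 'a set \<Rightarrow> bool" where
  "canalytic1_on D J f A \<longleftrightarrow> f ` A \<subseteq> csub D \<and> canalytic_on (\<lambda>x. cext J (f x)) A"

definition has_gradient ::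
    "('a :: real_inner complexification \<Rightarrow> complex) \<Rightarrow> 'a complexification
     \<Rightarrow> 'a complexification \<Rightarrow> bool" where
  "has_gradient f G x \<longleftrightarrow> (f has_derivative cinner G) (at x)"

definition has_gradientW :: "('d :: finite WC \<Rightarrow> complex) \<Rightarrow> 'd WC \<Rightarrow> 'd WC \<Rightarrow> bool" where
  "has_gradientW f G w \<longleftrightarrow>
     (f has_derivative (\<lambda>h. cinner (fst G) (fst h) + cinner (snd G) (snd h))) (at w)"

section \<open>The hypotheses\<close>

text \<open>Unbounded operators on \<open>Z\<close> are pairs of a domain \<open>D\<close> and a function \<open>T\<close>, whose values
  outside \<open>D\<close> are irrelevant.\<close>

definition skew_operator :: "'z :: real_inner set \<Rightarrow> ('z \<Rightarrow> 'z) \<Rightarrow> bool" where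
  "skew_operator D T \<longleftrightarrow>
     subspace D \<and>
     (\<forall>x\<in>D. \<forall>y\<in>D. T (x + y) = T x + T y) \<and> (\<forall>r. \<forall>x\<in>D. T (r *\<^sub>R x) = r *\<^sub>R T x) \<and>
     closure D = UNIV \<and>
     closed {(x, T x) | x. x \<in> D} \<and>
     (\<forall>x\<in>D. \<forall>y\<in>D. T x \<bullet> y = - (x \<bullet> T y)) \<and>
     bij_betw T D UNIV \<and> bounded_linear (inv_into D T)"

definition hyp_H0 :: "'z :: real_inner set \<Rightarrow> ('z \<Rightarrow> 'z) \<Rightarrow> ('z \<Rightarrow> 'z) \<Rightarrow> bool" where
  "hyp_H0 D J L \<longleftrightarrow>
     skew_operator D J \<and>
     skew_operator {z. L z \<in> D} (\<lambda>z. J (L z)) \<and>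
     bounded_linear L \<and> (\<forall>x y. L x \<bullet> y = x \<bullet> L y)"

definition hyp_system ::
    "'z :: real_inner set \<Rightarrow> ('z \<Rightarrow> 'z) \<Rightarrow> ('z \<Rightarrow> 'z) \<Rightarrow> 'd :: finite W set \<Rightarrow> 'z set
     \<Rightarrow> real \<Rightarrow> real
     \<Rightarrow> ('d WC \<times> 'z complexification \<Rightarrow> complex) \<Rightarrow> ('d WC \<times> 'z complexification \<Rightarrow> complex)
     \<Rightarrow> bool" where
  "hyp_system D J L V S \<nu>0 \<sigma>0 H V0 \<longleftrightarrow>
     onorm (inv_into D J) \<le> 1 \<and>
     (\<forall>w \<in> tubeW V \<nu>0. \<forall>z \<in> tubeZ S \<sigma>0. H (w, z) = cinner (cext L z) z / 2 + V0 (w, z)) \<and>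
     (\<exists>G. (\<forall>w \<in> tubeW V \<nu>0. \<forall>z \<in> tubeZ S \<sigma>0. has_gradient (\<lambda>z'. V0 (w, z')) (G (w, z)) z) \<and>
          G ` (tubeW V \<nu>0 \<times> tubeZ S \<sigma>0) \<subseteq> csub D \<and>
          canalytic_on (\<lambda>p. cext J (G p)) (tubeW V \<nu>0 \<times> tubeZ S \<sigma>0))"

definition hyp_expansion ::
    "('z :: real_inner \<Rightarrow> 'z) \<Rightarrow> 'd :: finite W set \<Rightarrow> 'z set \<Rightarrow> real \<Rightarrow> real
     \<Rightarrow> ('d WC \<times> 'z complexification \<Rightarrow> complex)
     \<Rightarrow> ('d WC \<Rightarrow> complex) \<Rightarrow> ('d WC \<Rightarrow> 'z complexification)
     \<Rightarrow> ('d WC \<Rightarrow> 'z complexification \<Rightarrow> 'z complexification)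
     \<Rightarrow> ('d WC \<times> 'z complexification \<Rightarrow> complex)
     \<Rightarrow> ('d WC \<times> 'z complexification \<Rightarrow> 'z complexification) \<Rightarrow> bool" where
  "hyp_expansion L V S \<nu>0 \<sigma>0 H h0 r0 a0 f0 F0 \<longleftrightarrow>
     (\<forall>w \<in> tubeW V \<nu>0. \<forall>z \<in> tubeZ S \<sigma>0.
        H (w, z) = h0 w + cinner (r0 w) z + cinner (cext L z + a0 w z) z / 2 + f0 (w, z) \<and>
        has_gradient (\<lambda>z'. f0 (w, z')) (F0 (w, z)) z) \<and>
     (\<forall>w \<in> tubeW V \<nu>0. (\<lambda>z. f0 (w, z)) \<in> O[nhds 0](\<lambda>z. of_real (norm z ^ 3)))"

definition hyp_H1 ::
    "'d :: finite W set \<Rightarrow> 'z :: real_inner set \<Rightarrow> real \<Rightarrow> real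
     \<Rightarrow> ('d WC \<times> 'z complexification \<Rightarrow> complex) \<Rightarrow> bool" where
  "hyp_H1 V S \<nu>0 \<sigma>0 H \<longleftrightarrow>
     open V \<and> open S \<and> 0 \<in> S \<and> \<nu>0 > 0 \<and> \<sigma>0 > 0 \<and>
     bounded (tubeZ S \<sigma>0) \<and>
     canalytic_on H (tubeW V \<nu>0 \<times> tubeZ S \<sigma>0) \<and>
     real_on (range cxW \<times> range cx) \<real> H (tubeW V \<nu>0 \<times> tubeZ S \<sigma>0) \<and>
     bounded (H ` (tubeW V \<nu>0 \<times> tubeZ S \<sigma>0))"

definition hyp_H2 ::
    "'z :: real_inner set \<Rightarrow> ('z \<Rightarrow> 'z) \<Rightarrow> ('z \<Rightarrow> 'z) \<Rightarrow> 'd :: finite W set \<Rightarrow> real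
     \<Rightarrow> real \<Rightarrow> real
     \<Rightarrow> ('d WC \<Rightarrow> 'z complexification \<Rightarrow> 'z complexification) \<Rightarrow> bool" where
  "hyp_H2 D J L V \<nu>0 C_a K0 a0 \<longleftrightarrow>
     (\<forall>w \<in> tubeW V \<nu>0. clinear (a0 w) \<and>
        (\<forall>z. a0 w z \<in> csub D \<and> norm1 J (a0 w z) \<le> C_a * norm z)) \<and>
     canalytic_on (\<lambda>w. Blinfun (\<lambda>z. cext J (a0 w z))) (tubeW V \<nu>0) \<and>
     real_on (range cxW) {T. T ` range cx \<subseteq> range cx} a0 (tubeW V \<nu>0) \<and>
     (\<forall>w \<in> tubeW V \<nu>0. let A0 = (\<lambda>z. cext L z + a0 w z) in
        bij_betw A0 (csub D) (csub D) \<and>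
        (\<forall>z \<in> csub D. norm1 J (inv_into (csub D) A0 z) \<le> K0 / 2 * norm1 J z))"

definition hyp_H3 ::
    "'z :: real_inner set \<Rightarrow> ('z \<Rightarrow> 'z) \<Rightarrow> 'd :: finite W set \<Rightarrow> 'z set \<Rightarrow> real \<Rightarrow> real
     \<Rightarrow> real \<Rightarrow> real \<Rightarrow> real \<Rightarrow> real \<Rightarrow> real
     \<Rightarrow> ('d WC \<Rightarrow> complex) \<Rightarrow> ('d WC \<Rightarrow> 'z complexification)
     \<Rightarrow> ('d WC \<times> 'z complexification \<Rightarrow> complex)
     \<Rightarrow> ('d WC \<times> 'z complexification \<Rightarrow> 'z complexification) \<Rightarrow> bool" where
  "hyp_H3 D J V S \<nu>0 \<sigma>0 \<delta>0 C_h C_h' C_F C_f h0 r0 f0 F0 \<longleftrightarrow>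
     canalytic1_on D J r0 (tubeW V \<nu>0) \<and> real_on (range cxW) (range cx) r0 (tubeW V \<nu>0) \<and>
     canalytic_on h0 (tubeW V \<nu>0) \<and> real_on (range cxW) \<real> h0 (tubeW V \<nu>0) \<and>
     canalytic_on f0 (tubeW V \<nu>0 \<times> tubeZ S \<sigma>0) \<and>
     real_on (range cxW \<times> range cx) \<real> f0 (tubeW V \<nu>0 \<times> tubeZ S \<sigma>0) \<and>
     canalytic1_on D J F0 (tubeW V \<nu>0 \<times> tubeZ S \<sigma>0) \<and>
     real_on (range cxW \<times> range cx) (range cx) F0 (tubeW V \<nu>0 \<times> tubeZ S \<sigma>0) \<and>
     (\<forall>w \<in> tubeW V \<nu>0. norm1 J (r0 w) \<le> \<delta>0 \<and> cmod (h0 w) \<le> C_h \<and>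
        onorm (frechet_derivative h0 (at w)) \<le> C_h') \<and>
     (\<forall>p \<in> tubeW V \<nu>0 \<times> tubeZ S \<sigma>0. norm1 J (F0 p) \<le> C_F \<and> cmod (f0 p) \<le> C_f)"

section \<open>The transformation\<close>

definition zeta_eq ::
    "('z :: real_inner \<Rightarrow> 'z) \<Rightarrow> ('d :: finite WC \<Rightarrow> 'z complexification)
     \<Rightarrow> ('d WC \<Rightarrow> 'z complexification \<Rightarrow> 'z complexification)
     \<Rightarrow> ('d WC \<times> 'z complexification \<Rightarrow> 'z complexification)
     \<Rightarrow> 'd WC \<Rightarrow> 'z complexification \<Rightarrow> bool" where
  "zeta_eq L r0 a0 F0 w z \<longleftrightarrow> r0 w + (cext L z + a0 w z) + F0 (w, z) = 0"

definition is_zeta ::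
    "'z :: real_inner set \<Rightarrow> ('z \<Rightarrow> 'z) \<Rightarrow> ('z \<Rightarrow> 'z) \<Rightarrow> 'd :: finite W set \<Rightarrow> 'z set
     \<Rightarrow> real \<Rightarrow> real \<Rightarrow> real \<Rightarrow> ('d WC \<Rightarrow> 'z complexification)
     \<Rightarrow> ('d WC \<Rightarrow> 'z complexification \<Rightarrow> 'z complexification)
     \<Rightarrow> ('d WC \<times> 'z complexification \<Rightarrow> 'z complexification)
     \<Rightarrow> ('d WC \<Rightarrow> 'z complexification) \<Rightarrow> bool" where
  "is_zeta D J L V S \<nu>0 \<sigma>0 K0 r0 a0 F0 \<zeta> \<longleftrightarrow>
     canalytic1_on D J \<zeta> (tubeW V \<nu>0) \<and>
     (\<forall>w \<in> tubeW V \<nu>0.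
        \<zeta> w \<in> tubeZ S \<sigma>0 \<and> zeta_eq L r0 a0 F0 w (\<zeta> w) \<and>
        norm1 J (\<zeta> w) \<le> K0 * norm1 J (r0 w) \<and>
        (\<exists>\<rho>>0. \<forall>z \<in> csub D \<inter> tubeZ S \<sigma>0.
            norm1 J (z - \<zeta> w) < \<rho> \<and> zeta_eq L r0 a0 F0 w z \<longrightarrow> z = \<zeta> w))"

definition complementary_projectors :: "('z :: real_inner \<Rightarrow> 'z) \<Rightarrow> ('z \<Rightarrow> 'z) \<Rightarrow> bool" where
  "complementary_projectors Px Py \<longleftrightarrow>
     bounded_linear Px \<and> bounded_linear Py \<and>
     (\<forall>z. Px (Px z) = Px z) \<and> (\<forall>z. Py (Py z) = Py z) \<and>
     (\<forall>z. Px z + Py z = z) \<and> (\<forall>z. Px (Py z) = 0) \<and> (\<forall>z z'. Px z \<bullet> Py z' = 0)"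

text \<open>The pair \<open>(x, y)\<close> with \<open>x\<close>, \<open>y\<close> in the ranges of the two projectors is the vector \<open>x + y\<close>.\<close>

definition gfun ::
    "'z :: real_inner set \<Rightarrow> ('z \<Rightarrow> 'z) \<Rightarrow> ('d :: finite WC \<Rightarrow> 'z complexification)
     \<Rightarrow> (real ^ 'd) complexification \<Rightarrow> (real ^ 'd) complexification
     \<Rightarrow> 'z complexification \<Rightarrow> 'z complexification \<Rightarrow> complex" where
  "gfun D J \<zeta> u v x y = - cinner (cext (inv_into D J) (\<zeta> (u, v))) (x + y)"

definition symp_form ::
    "real \<Rightarrow> 'z :: real_inner set \<Rightarrow> ('z \<Rightarrow> 'z)
     \<Rightarrow> 'd :: finite WC \<times> 'z complexification \<Rightarrow> 'd WC \<times> 'z complexification \<Rightarrow> complex" where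
  "symp_form \<epsilon> D J = (\<lambda>((u1, v1), z1) ((u2, v2), z2).
     (cinner u1 v2 - cinner u2 v1) / of_real \<epsilon> + cinner (cext (inv_into D J) z1) z2)"

definition symplectic_on ::
    "real \<Rightarrow> 'z :: real_inner set \<Rightarrow> ('z \<Rightarrow> 'z)
     \<Rightarrow> ('d :: finite WC \<times> 'z complexification \<Rightarrow> 'd WC \<times> 'z complexification)
     \<Rightarrow> ('d WC \<times> 'z complexification) set \<Rightarrow> bool" where
  "symplectic_on \<epsilon> D J \<Psi> A \<longleftrightarrow> (\<forall>p\<in>A. \<exists>\<Psi>'. (\<Psi> has_derivative \<Psi>') (at p) \<and>
     (\<forall>h k. symp_form \<epsilon> D J (\<Psi>' h) (\<Psi>' k) = symp_form \<epsilon> D J h k))"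

text \<open>The equation \<open>u\<^sub>+ = u + \<epsilon> \<nabla>\<^sub>v g(u, v\<^sub>+, x, y\<^sub>+)\<close> with \<open>x = x\<^sub>+ + \<zeta>\<^sup>x(u, v\<^sub>+)\<close> substituted
  after the differentiation.\<close>

definition u_eq ::
    "real \<Rightarrow> 'z :: real_inner set \<Rightarrow> ('z \<Rightarrow> 'z) \<Rightarrow> ('z \<Rightarrow> 'z)
     \<Rightarrow> ('d :: finite WC \<Rightarrow> 'z complexification)
     \<Rightarrow> (real ^ 'd) complexification \<Rightarrow> (real ^ 'd) complexification
     \<Rightarrow> 'z complexification \<Rightarrow> 'z complexification \<Rightarrow> (real ^ 'd) complexification \<Rightarrow> bool" where
  "u_eq \<epsilon> D J Px \<zeta> up vp xp yp u \<longleftrightarrow>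
     (\<exists>gv. has_gradient (\<lambda>v'. gfun D J \<zeta> u v' (xp + cext Px (\<zeta> (u, vp))) yp) gv vp \<and>
        up = u + \<epsilon> *\<^sub>R gv)"

definition Psi_rel ::
    "real \<Rightarrow> 'z :: real_inner set \<Rightarrow> ('z \<Rightarrow> 'z) \<Rightarrow> ('z \<Rightarrow> 'z) \<Rightarrow> ('z \<Rightarrow> 'z)
     \<Rightarrow> ('d :: finite WC \<Rightarrow> 'z complexification)
     \<Rightarrow> 'd WC \<times> 'z complexification \<Rightarrow> 'd WC \<times> 'z complexification \<Rightarrow> bool" where
  "Psi_rel \<epsilon> D J Px Py \<zeta> = (\<lambda>((up, vp), zp) ((u, v), z).
     let xp = cext Px zp; yp = cext Py zp; x = cext Px z; y = cext Py z in
       xp = x - cext Px (\<zeta> (u, vp)) \<and>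
       y = yp + cext Py (\<zeta> (u, vp)) \<and>
       (\<exists>gv. has_gradient (\<lambda>v'. gfun D J \<zeta> u v' x yp) gv vp \<and> up = u + \<epsilon> *\<^sub>R gv) \<and>
       (\<exists>gu. has_gradient (\<lambda>u'. gfun D J \<zeta> u' vp x yp) gu u \<and> v = vp + \<epsilon> *\<^sub>R gu))"

definition is_Psi ::
    "real \<Rightarrow> 'z :: real_inner set \<Rightarrow> ('z \<Rightarrow> 'z) \<Rightarrow> ('z \<Rightarrow> 'z) \<Rightarrow> ('z \<Rightarrow> 'z)
     \<Rightarrow> 'd :: finite W set \<Rightarrow> 'z set \<Rightarrow> real \<Rightarrow> real \<Rightarrow> real
     \<Rightarrow> ('d WC \<Rightarrow> 'z complexification)
     \<Rightarrow> ('d WC \<times> 'z complexification \<Rightarrow> 'd WC \<times> 'z complexification) \<Rightarrow> bool" where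
  "is_Psi \<epsilon> D J Px Py V S \<nu>0 \<sigma>0 \<xi> \<zeta> \<Psi> \<longleftrightarrow>
     (let A = tubeW V (\<nu>0 - \<xi>) \<times> tubeZ S (\<sigma>0 - \<xi>) in
       \<Psi> ` A \<subseteq> tubeW V (\<nu>0 - \<xi> / 2) \<times> tubeZ S (\<sigma>0 - \<xi> / 2) \<and>
       canalytic_on \<Psi> A \<and>
       symplectic_on \<epsilon> D J \<Psi> A \<and>
       (\<forall>up vp zp. ((up, vp), zp) \<in> A \<longrightarrow>
          Psi_rel \<epsilon> D J Px Py \<zeta> ((up, vp), zp) (\<Psi> ((up, vp), zp)) \<and>
          norm (fst (fst (\<Psi> ((up, vp), zp))) - up) \<le> \<xi> / 2 \<and>
          (\<forall>u. norm (u - up) \<le> \<xi> / 2 \<and> u_eq \<epsilon> D J Px \<zeta> up vp (cext Px zp) (cext Py zp) u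
             \<longrightarrow> u = fst (fst (\<Psi> ((up, vp), zp))))))"

section \<open>Equilibria\<close>

definition J_W :: "'a \<times> 'a \<Rightarrow> 'a \<times> 'a :: uminus" where
  "J_W w = (snd w, - fst w)"

text \<open>Zeros of the right-hand side \<open>(\<epsilon> J\<^sub>W \<nabla>\<^sub>w H, J \<nabla>\<^sub>z H)\<close>. This includes \<open>\<nabla>\<^sub>z H\<close> lying in the
  domain of \<open>J\<close>.\<close>

definition is_equilibrium ::
    "real \<Rightarrow> 'z :: real_inner set \<Rightarrow> ('z \<Rightarrow> 'z)
     \<Rightarrow> ('d :: finite WC \<times> 'z complexification \<Rightarrow> complex) \<Rightarrow> 'd W \<Rightarrow> 'z \<Rightarrow> bool" where
  "is_equilibrium \<epsilon> D J H w z \<longleftrightarrow> (\<exists>Gw Gz.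
     has_gradientW (\<lambda>w'. H (w', cx z)) Gw (cxW w) \<and>
     has_gradient (\<lambda>z'. H (cxW w, z')) Gz (cx z) \<and>
     \<epsilon> *\<^sub>R J_W Gw = 0 \<and> Gz \<in> csub D \<and> cext J Gz = 0)"

definition locally_unique_equilibrium ::
    "real \<Rightarrow> 'z :: real_inner set \<Rightarrow> ('z \<Rightarrow> 'z) \<Rightarrow> 'd :: finite W set \<Rightarrow> 'z set
     \<Rightarrow> ('d WC \<times> 'z complexification \<Rightarrow> complex) \<Rightarrow> 'd W \<Rightarrow> 'z \<Rightarrow> bool" where
  "locally_unique_equilibrium \<epsilon> D J V S H w z \<longleftrightarrow>
     w \<in> V \<and> z \<in> S \<and> is_equilibrium \<epsilon> D J H w z \<and>
     (\<exists>\<rho>>0. \<forall>w'\<in>V. \<forall>z'\<in>S. dist (w', z') (w, z) < \<rho> \<and> is_equilibrium \<epsilon> D J H w' z'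
        \<longrightarrow> (w', z') = (w, z))"

end

theory Submission
  imports Defs
begin

text \<open>
  The transformation does not move the equilibrium \<open>(w\<^sup>e, 0)\<close> because the shift \<open>\<zeta>\<close> vanishes there.
  The \<open>z\<close>-gradient of the Hamiltonian at \<open>z = 0\<close> is \<open>r\<^sub>0(w)\<close>: the quadratic part and
  \<open>f\<^sub>0 = O(\<parallel>z\<parallel>\<^sup>3)\<close> do not contribute. Since \<open>J\<close> is injective, an equilibrium at \<open>z = 0\<close>
  therefore forces \<open>r\<^sub>0(w\<^sup>e) = 0\<close> (\<open>equilibrium_imp_r0_zero\<close>), and the bound of
  \<open>\<parallel>\<zeta>(w)\<parallel>\<^sub>1\<close> by \<open>K\<^sub>0 \<parallel>r\<^sub>0(w)\<parallel>\<^sub>1\<close> gives \<open>\<zeta>(w\<^sup>e) = 0\<close>.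

  The generating function \<open>g(u, v\<^sub>+, x, y\<^sub>+)\<close> is linear in \<open>(x, y\<^sub>+)\<close>, so it vanishes identically
  in \<open>(u, v\<^sub>+)\<close> when \<open>x = y\<^sub>+ = 0\<close>, together with its gradients in \<open>u\<close> and \<open>v\<^sub>+\<close>. Hence
  \<open>u = u\<^sup>e\<close> solves the implicit equation for \<open>u\<close> at \<open>(w\<^sup>e, 0)\<close>; by uniqueness it is the
  \<open>u\<close>-component of the image, and the remaining three equations of the transformation become
  \<open>x = 0\<close>, \<open>y = 0\<close> and \<open>v = v\<^sup>e\<close> (\<open>Psi_fixed_point\<close>).
\<close>

section \<open>The complexified space and its bilinear form\<close>

lemma complexification_eqI: "cRe x = cRe y \<Longrightarrow> cIm x = cIm y \<Longrightarrow> x = y"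
  by (simp add: complexification.expand)

lemma cRe_zero [simp]: "cRe 0 = 0" and cIm_zero [simp]: "cIm 0 = 0"
  by (simp_all add: zero_complexification_def)

lemma cRe_add [simp]: "cRe (x + y) = cRe x + cRe y"
  and cIm_add [simp]: "cIm (x + y) = cIm x + cIm y"
  by (simp_all add: plus_complexification_def)

lemma cRe_scaleR [simp]: "cRe (r *\<^sub>R x) = r *\<^sub>R cRe x"
  and cIm_scaleR [simp]: "cIm (r *\<^sub>R x) = r *\<^sub>R cIm x"
  by (simp_all add: scaleR_complexification_def)

lemma cRe_cext [simp]: "cRe (cext T z) = T (cRe z)"
  and cIm_cext [simp]: "cIm (cext T z) = T (cIm z)"
  by (simp_all add: complexification.map_sel)

lemma cx_zero [simp]: "cx 0 = 0"
  by (simp add: cx_def zero_complexification_def)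

lemma cinner_zero_right [simp]: "cinner x 0 = 0"
  and cinner_zero_left [simp]: "cinner 0 x = 0"
  by (simp_all add: cinner_def complex_eq_iff)

lemma cinner_scaleR_right: "cinner x (r *\<^sub>R y) = of_real r * cinner x y"
  and cinner_scaleR_left: "cinner (r *\<^sub>R x) y = of_real r * cinner x y"
  by (simp_all add: cinner_def complex_eq_iff algebra_simps)

text \<open>Pairing \<open>a + i b\<close> with its conjugate \<open>a - i b\<close> gives \<open>\<parallel>a\<parallel>\<^sup>2 + \<parallel>b\<parallel>\<^sup>2\<close>.\<close>

lemma cinner_nondegenerate:
  assumes "\<And>h. cinner r h = 0"
  shows "r = 0"
proof -
  have "cinner r (Cx (cRe r) (- cIm r)) = 0" by (rule assms)
  then have "cRe r \<bullet> cRe r + cIm r \<bullet> cIm r = 0"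
    by (simp add: cinner_def complex_eq_iff)
  then show ?thesis
    by (intro complexification_eqI) (simp_all add: add_nonneg_eq_0_iff)
qed

text \<open>Being a derivative, \<open>cinner G\<close> is unique, and \<open>cinner\<close> determines \<open>G\<close>.\<close>

lemma has_gradient_const_imp_zero:
  assumes "has_gradient (\<lambda>_. c) G x"
  shows "G = 0"
proof (rule cinner_nondegenerate)
  have "((\<lambda>_. c) has_derivative cinner G) (at x)"
    using assms by (simp add: has_gradient_def)
  then have "cinner G = (\<lambda>_. 0)"
    by (rule has_derivative_unique) (rule has_derivative_const)
  then show "cinner G h = 0" for h by simp
qed

lemma has_gradient_const: "has_gradient (\<lambda>_. c) 0 (x :: 'a :: real_inner complexification)"
proof -
  have "cinner (0 :: 'a complexification) = (\<lambda>_. 0)" by (simp add: fun_eq_iff)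
  then show ?thesis by (simp only: has_gradient_def has_derivative_const)
qed

section \<open>Injectivity of skew operators\<close>

lemma skew_operator_zero:
  assumes "skew_operator D T"
  shows "0 \<in> D" and "T 0 = 0"
proof -
  show "0 \<in> D" using assms by (auto simp: skew_operator_def subspace_def)
  then have "T (0 *\<^sub>R 0) = 0 *\<^sub>R T 0" using assms unfolding skew_operator_def by blast
  then show "T 0 = 0" by simp
qed

lemma skew_operator_cext_eq_zero:
  assumes T: "skew_operator D T" and z: "z \<in> csub D" "cext T z = 0"
  shows "z = 0"
proof -
  have inj: "inj_on T D" using T by (auto simp: skew_operator_def bij_betw_def)
  have "T (cRe z) = 0" "T (cIm z) = 0"
    using arg_cong[OF z(2), of cRe] arg_cong[OF z(2), of cIm] by simp_all
  then have "T (cRe z) = T 0" "T (cIm z) = T 0" by (simp_all add: skew_operator_zero[OF T])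
  moreover have "cRe z \<in> D" "cIm z \<in> D" using z(1) by (simp_all add: csub_def)
  ultimately have "cRe z = 0" "cIm z = 0"
    using inj skew_operator_zero(1)[OF T] by (auto dest: inj_onD)
  then show ?thesis by (intro complexification_eqI) simp_all
qed

section \<open>The gradient at zero and the shift\<close>

lemma cubic_bigo_has_derivative_zero:
  fixes f :: "'a :: real_normed_vector \<Rightarrow> complex"
  assumes "f \<in> O[nhds 0](\<lambda>z. of_real (norm z ^ 3))"
  shows "(f has_derivative (\<lambda>_. 0)) (at 0)"
proof -
  obtain c where "eventually (\<lambda>z. norm (f z) \<le> c * norm z ^ 3) (nhds 0)"
    using assms by (auto elim!: landau_o.bigE simp: norm_power)
  then have f0: "f 0 = 0" and ev: "eventually (\<lambda>z. norm (f z) \<le> c * norm z ^ 3) (at 0)"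
    by (auto dest: eventually_nhds_x_imp_x simp: eventually_at_filter elim: eventually_mono)
  have "((\<lambda>z. norm (f z) / norm z) \<longlongrightarrow> 0) (at 0)"
  proof (rule Lim_null_comparison)
    show "eventually (\<lambda>z. norm (norm (f z) / norm z) \<le> c * norm z ^ 2) (at 0)"
      using ev eventually_neq_at_within[of 0 0]
      by eventually_elim (simp add: field_simps power2_eq_square power3_eq_cube)
    have "((\<lambda>z::'a. c * norm z ^ 2) \<longlongrightarrow> c * norm (0::'a) ^ 2) (at 0)"
      by (intro tendsto_intros)
    then show "((\<lambda>z::'a. c * norm z ^ 2) \<longlongrightarrow> 0) (at 0)" by simp
  qed
  then show ?thesis
    by (simp add: has_derivative_at f0 tendsto_norm_zero_iff flip: norm_divide)
qed

text \<open>Differentiating along the lines \<open>t \<mapsto> t h\<close> turns the quadratic part into \<open>t\<^sup>2\<close> times a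
  constant by homogeneity of \<open>A\<close>, so its derivative at \<open>t = 0\<close> vanishes.\<close>

lemma gradient_at_zero_eq_linear_part:
  fixes r G :: "'a :: real_inner complexification"
  assumes U: "open U" "0 \<in> U"
    and E: "\<And>z. z \<in> U \<Longrightarrow> H z = c + cinner r z + cinner (A z) z / 2 + f z"
    and A: "\<And>t z. A (t *\<^sub>R z) = t *\<^sub>R A z"
    and f: "f \<in> O[nhds 0](\<lambda>z. of_real (norm z ^ 3))"
    and G: "has_gradient H G 0"
  shows "cinner G h = cinner r h"
proof -
  have line: "((\<lambda>t::real. t *\<^sub>R h) has_derivative (\<lambda>t. t *\<^sub>R h)) (at 0)"
    by (auto intro!: derivative_eq_intros)
  have "((\<lambda>t::real. H (t *\<^sub>R h)) has_derivative (\<lambda>t. cinner G (t *\<^sub>R h))) (at 0)"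
    using has_derivative_compose[OF line, of H "cinner G"] G by (simp add: has_gradient_def)
  moreover have "eventually (\<lambda>t::real. t *\<^sub>R h \<in> U) (nhds 0)"
  proof -
    have "((\<lambda>t::real. t *\<^sub>R h) \<longlongrightarrow> 0 *\<^sub>R h) (nhds 0)" by (intro tendsto_intros filterlim_ident)
    then show ?thesis using U by (auto dest: topological_tendstoD)
  qed
  then have ev: "eventually (\<lambda>t::real. H (t *\<^sub>R h) =
      c + of_real t * cinner r h + (of_real t)\<^sup>2 * (cinner (A h) h / 2) + f (t *\<^sub>R h)) (nhds 0)"
    by eventually_elim
      (simp add: E A cinner_scaleR_left cinner_scaleR_right power2_eq_square)
  ultimately have "((\<lambda>t::real. c + of_real t * cinner r h + (of_real t)\<^sup>2 * (cinner (A h) h / 2)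
      + f (t *\<^sub>R h)) has_derivative (\<lambda>t. cinner G (t *\<^sub>R h))) (at 0)"
    using eventually_nhds_x_imp_x[OF ev]
    by (elim has_derivative_transform_eventually) (auto simp: eventually_at_filter elim: eventually_mono)
  moreover have "((\<lambda>t::real. f (t *\<^sub>R h)) has_derivative (\<lambda>_. 0)) (at 0)"
    using has_derivative_compose[OF line, of f "\<lambda>_. 0"] cubic_bigo_has_derivative_zero[OF f]
    by simp
  then have "((\<lambda>t::real. c + of_real t * cinner r h + (of_real t)\<^sup>2 * (cinner (A h) h / 2)
      + f (t *\<^sub>R h)) has_derivative (\<lambda>t. of_real t * cinner r h)) (at 0)"
    by (auto intro!: derivative_eq_intros)
  ultimately have "(\<lambda>t::real. cinner G (t *\<^sub>R h)) = (\<lambda>t. of_real t * cinner r h)"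
    by (rule has_derivative_unique)
  from fun_cong[OF this, of 1] show ?thesis by simp
qed

lemma mem_tubeI: "a \<in> A \<Longrightarrow> 0 < r \<Longrightarrow> a \<in> tube A r"
  by (auto simp: tube_def intro!: bexI[of _ a])

lemma cxW_mem_tubeW: "w \<in> V \<Longrightarrow> 0 < \<nu> \<Longrightarrow> cxW w \<in> tubeW V \<nu>"
  by (simp add: tubeW_def mem_tubeI)

lemma zero_mem_tubeZ: "0 \<in> S \<Longrightarrow> 0 < \<sigma> \<Longrightarrow> 0 \<in> tubeZ S \<sigma>"
  unfolding tubeZ_def by (rule mem_tubeI) (auto intro!: image_eqI[where x = 0])

lemma open_tubeZ: "open (tubeZ S \<sigma>)"
  by (auto simp: tubeZ_def tube_def)

lemma equilibrium_imp_r0_zero: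
  assumes H0: "hyp_H0 D J L"
    and exp: "hyp_expansion L V S \<nu>0 \<sigma>0 H h0 r0 a0 f0 F0"
    and a0: "clinear (a0 (cxW w))"
    and dom: "w \<in> V" "0 \<in> S" "0 < \<nu>0" "0 < \<sigma>0"
    and eq: "is_equilibrium \<epsilon> D J H w 0"
  shows "r0 (cxW w) = 0"
proof (rule cinner_nondegenerate)
  fix h
  have J: "skew_operator D J" and L: "bounded_linear L"
    using H0 by (auto simp: hyp_H0_def)
  obtain Gz where Gz: "has_gradient (\<lambda>z'. H (cxW w, z')) Gz 0" "Gz \<in> csub D" "cext J Gz = 0"
    using eq by (auto simp: is_equilibrium_def)
  have "Gz = 0" by (rule skew_operator_cext_eq_zero[OF J Gz(2,3)])
  have w: "cxW w \<in> tubeW V \<nu>0" using dom by (simp add: cxW_mem_tubeW)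
  have "cinner Gz h = cinner (r0 (cxW w)) h"
  proof (rule gradient_at_zero_eq_linear_part[OF open_tubeZ zero_mem_tubeZ[OF dom(2,4)] _ _ _ Gz(1)])
    show "H (cxW w, z) = h0 (cxW w) + cinner (r0 (cxW w)) z
        + cinner (cext L z + a0 (cxW w) z) z / 2 + f0 (cxW w, z)" if "z \<in> tubeZ S \<sigma>0" for z
      using exp w that by (simp add: hyp_expansion_def)
    show "(\<lambda>z. f0 (cxW w, z)) \<in> O[nhds 0](\<lambda>z. of_real (norm z ^ 3))"
      using exp w by (simp add: hyp_expansion_def)
    have "cext L (t *\<^sub>R z) = t *\<^sub>R cext L z" for t z
      by (rule complexification_eqI)
        (simp_all add: linear_scale[OF bounded_linear.linear[OF L]])
    then show "cext L (t *\<^sub>R z) + a0 (cxW w) (t *\<^sub>R z) = t *\<^sub>R (cext L z + a0 (cxW w) z)" for t z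
      using a0 by (simp add: clinear_def linear_scale scaleR_add_right)
  qed
  then show "cinner (r0 (cxW w)) h = 0" using \<open>Gz = 0\<close> by simp
qed

lemma zeta_zero_of_r0_zero:
  assumes J: "skew_operator D J" and \<zeta>: "is_zeta D J L V S \<nu>0 \<sigma>0 K0 r0 a0 F0 \<zeta>"
    and w: "w \<in> tubeW V \<nu>0" and r0: "r0 w = 0"
  shows "\<zeta> w = 0"
proof (rule skew_operator_cext_eq_zero[OF J])
  show "\<zeta> w \<in> csub D" using \<zeta> w by (auto simp: is_zeta_def canalytic1_on_def)
  have "cext J 0 = 0"
    by (rule complexification_eqI) (simp_all add: skew_operator_zero[OF J])
  moreover have "norm1 J (\<zeta> w) \<le> K0 * norm1 J (r0 w)"
    using \<zeta> w by (simp add: is_zeta_def)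
  ultimately show "cext J (\<zeta> w) = 0" by (simp add: r0 norm1_def)
qed

section \<open>The transformation at a zero of the shift\<close>

lemma gfun_zero [simp]: "gfun D J \<zeta> u v 0 0 = 0"
  by (simp add: gfun_def)

lemma Psi_fixed_point:
  assumes P: "complementary_projectors Px Py"
    and Psi: "is_Psi \<epsilon> D J Px Py V S \<nu>0 \<sigma>0 \<xi> \<zeta> \<Psi>"
    and dom: "((u, v), 0) \<in> tubeW V (\<nu>0 - \<xi>) \<times> tubeZ S (\<sigma>0 - \<xi>)"
    and "0 < \<xi>" and \<zeta>: "\<zeta> (u, v) = 0"
  shows "\<Psi> ((u, v), 0) = ((u, v), 0)"
proof -
  have lin: "linear Px" "linear Py"
    using P by (auto simp: complementary_projectors_def bounded_linear.linear)
  have P0: "cext Px 0 = 0" "cext Py 0 = 0"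
    using lin by (auto intro!: complexification_eqI simp: linear_0)
  obtain u' v' z' where im: "\<Psi> ((u, v), 0) = ((u', v'), z')" by (metis surj_pair)
  have rel: "Psi_rel \<epsilon> D J Px Py \<zeta> ((u, v), 0) ((u', v'), z')"
    using Psi dom im unfolding is_Psi_def Let_def by metis
  \<comment> \<open>Here \<open>x = P\<^sub>x \<zeta>(u, v) = 0\<close>, so \<open>g\<close> is constant in \<open>v\<^sub>+\<close> and the zero gradient is a witness.\<close>
  have "u_eq \<epsilon> D J Px \<zeta> u v (cext Px 0) (cext Py 0) u"
    unfolding u_eq_def by (intro exI[of _ 0]) (simp add: P0 \<zeta> has_gradient_const)
  then have u': "u' = u"
    using Psi dom im \<open>0 < \<xi>\<close> unfolding is_Psi_def Let_def
    by (metis (no_types, lifting) diff_self fst_conv half_gt_zero norm_zero order_less_imp_le)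
  have x: "cext Px z' = 0" and y: "cext Py z' = 0"
    using rel by (simp_all add: Psi_rel_def u' \<zeta> P0 Let_def)
  have "cext Px z' + cext Py z' = z'"
    using P by (auto intro!: complexification_eqI simp: complementary_projectors_def)
  then have z': "z' = 0" using x y by simp
  obtain gu where gu: "has_gradient (\<lambda>u''. gfun D J \<zeta> u'' v 0 0) gu u" "v' = v + \<epsilon> *\<^sub>R gu"
    using rel by (auto simp: Psi_rel_def u' x P0 Let_def)
  then have "gu = 0" by (auto dest: has_gradient_const_imp_zero)
  then show ?thesis using gu(2) by (simp add: im u' z')
qed

theorem mainTheorem5:
  fixes D :: "'z :: {real_inner, complete_space} set" and J L Px Py :: "'z \<Rightarrow> 'z"
    and V :: "'d :: finite W set" and S :: "'z set"
    and \<nu>0 \<sigma>0 \<xi> K0 C_a C_h C_h' C_F C_f :: real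
  assumes "hyp_H0 D J L"
    and "complementary_projectors Px Py"
    and "0 < \<xi>" and "\<xi> < min \<nu>0 \<sigma>0"
  shows "\<exists>\<delta>s>0. \<exists>\<epsilon>s>0. \<forall>\<delta>0 \<epsilon>. 0 < \<delta>0 \<and> \<delta>0 < \<delta>s \<and> 0 < \<epsilon> \<and> \<epsilon> < \<epsilon>s \<longrightarrow>
    (\<forall>H V0 h0 r0 a0 f0 F0 \<zeta> \<Psi> we.
       hyp_system D J L V S \<nu>0 \<sigma>0 H V0 \<and>
       hyp_expansion L V S \<nu>0 \<sigma>0 H h0 r0 a0 f0 F0 \<and>
       hyp_H1 V S \<nu>0 \<sigma>0 H \<and>
       hyp_H2 D J L V \<nu>0 C_a K0 a0 \<and>
       hyp_H3 D J V S \<nu>0 \<sigma>0 \<delta>0 C_h C_h' C_F C_f h0 r0 f0 F0 \<and>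
       is_zeta D J L V S \<nu>0 \<sigma>0 K0 r0 a0 F0 \<zeta> \<and>
       is_Psi \<epsilon> D J Px Py V S \<nu>0 \<sigma>0 \<xi> \<zeta> \<Psi> \<and>
       locally_unique_equilibrium \<epsilon> D J V S H we 0 \<longrightarrow>
       \<Psi> (cxW we, 0) = (cxW we, 0))"
proof -
  have "\<Psi> (cxW we, 0) = (cxW we, 0)"
    if exp: "hyp_expansion L V S \<nu>0 \<sigma>0 H h0 r0 a0 f0 F0" and H1: "hyp_H1 V S \<nu>0 \<sigma>0 H"
      and H2: "hyp_H2 D J L V \<nu>0 C_a K0 a0"
      and zeta: "is_zeta D J L V S \<nu>0 \<sigma>0 K0 r0 a0 F0 \<zeta>"
      and Psi: "is_Psi \<epsilon> D J Px Py V S \<nu>0 \<sigma>0 \<xi> \<zeta> \<Psi>"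
      and eq: "locally_unique_equilibrium \<epsilon> D J V S H we 0"
    for \<epsilon> H h0 r0 a0 f0 F0 \<zeta> \<Psi> we
  proof -
    have dom: "we \<in> V" "0 \<in> S" "0 < \<nu>0" "0 < \<sigma>0"
      using H1 eq by (auto simp: hyp_H1_def locally_unique_equilibrium_def)
    have w: "cxW we \<in> tubeW V \<nu>0" using dom by (simp add: cxW_mem_tubeW)
    have J: "skew_operator D J" using assms(1) by (simp add: hyp_H0_def)
    have "r0 (cxW we) = 0"
    proof (rule equilibrium_imp_r0_zero[OF assms(1) exp _ dom])
      show "clinear (a0 (cxW we))" using H2 w by (simp add: hyp_H2_def)
      show "is_equilibrium \<epsilon> D J H we 0" using eq by (simp add: locally_unique_equilibrium_def)
    qed
    then have "\<zeta> (cxW we) = 0" by (rule zeta_zero_of_r0_zero[OF J zeta w])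
    moreover have "(cxW we, 0) \<in> tubeW V (\<nu>0 - \<xi>) \<times> tubeZ S (\<sigma>0 - \<xi>)"
      using dom assms(4) by (simp add: cxW_mem_tubeW zero_mem_tubeZ)
    ultimately show ?thesis
      using Psi_fixed_point[OF assms(2) Psi _ assms(3)] by (simp add: cxW_def)
  qed
  then show ?thesis by (intro exI[of _ 1] conjI) auto
qed

end
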